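(* Let $N\ge 2$ be an integer and let $p(i),q(i)>0$ with $p(i)+q(i)\le 1$ for $i\in\{1,\ldots,N-1\}$ be the winning and losing probabilities of a gambler's ruin game on $\{0,1,\ldots,N\}$; put $r(i)=q(i)/p(i)$. Let $0\le j\le i\le k\le N$ with $j<k$. Then $$\rho_{j:i:k}=\frac{\sum_{n=j+1}^{i}\prod_{s=j+1}^{n-1}r(s)}{\sum_{n=j+1}^{k}\prod_{s=j+1}^{n-1}r(s)}$$ and $$ET_{j:i:k}=\frac{\sum_{n=j+1}^{k-1}\Big[d_n\sum_{s=j+1}^{n}\frac{1}{p(s)d_s}\Big]}{\sum_{n=j}^{k-1}d_n}\;\sum_{n=j}^{i-1}d_n-\sum_{n=j+1}^{i-1}\Big[d_n\sum_{s=j+1}^{n}\frac{1}{p(s)d_s}\Big],$$ where $d_s=\prod_{l=j+1}^{s}r(l)$ for $j\le s\le k-1$ (so $d_j=1$).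
   Context: Set $p(0)=q(0)=p(N)=q(N)=0$. The gambler's ruin game is the Markov chain $(X_n)_{n\ge0}$ on $\{0,\ldots,N\}$ that moves from $i$ to $i+1$ with probability $p(i)$, from $i$ to $i-1$ with probability $q(i)$, and stays at $i$ with probability $1-p(i)-q(i)$. For $0\le j\le i\le k\le N$, $j<k$: $\rho_{j:i:k}$ is the probability that the chain started at $X_0=i$ reaches $k$ before $j$ (i.e. $P(\tau_k<\tau_j\mid X_0=i)$ for $\tau_l=\inf\{n\ge 0:X_n=l\}$), and $T_{j:i:k}=\inf\{n\ge0: X_n=j\text{ or }X_n=k\}$ for the chain started at $X_0=i$. $E$ denotes expectation. Empty sums equal $0$ and empty products equal $1$. *)

theory Defs
  imports "HOL-Probability.Probability"
begin

text \<open>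
  \<open>X\<close> is a time-homogeneous Markov chain on the countable state space \<open>S\<close> with
  transition probabilities \<open>K\<close>. The law of \<open>X 0\<close> is left arbitrary.
\<close>
definition markov_chain ::
    "'a measure \<Rightarrow> 's set \<Rightarrow> ('s \<Rightarrow> 's \<Rightarrow> real) \<Rightarrow> (nat \<Rightarrow> 'a \<Rightarrow> 's) \<Rightarrow> bool" where
  "markov_chain M S K X \<longleftrightarrow>
     prob_space M \<and>
     (\<forall>n. X n \<in> measurable M (count_space S)) \<and>
     (\<forall>n x y. (\<forall>m\<le>n. x m \<in> S) \<longrightarrow> y \<in> S \<longrightarrow>
        0 < \<P>(\<omega> in M. \<forall>m\<le>n. X m \<omega> = x m) \<longrightarrow>
        \<P>(\<omega> in M. X (Suc n) \<omega> = y \<bar> \<forall>m\<le>n. X m \<omega> = x m) = K (x n) y)"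

definition gr_trans :: "(nat \<Rightarrow> real) \<Rightarrow> (nat \<Rightarrow> real) \<Rightarrow> nat \<Rightarrow> nat \<Rightarrow> real" where
  "gr_trans p q x y =
     (if y = x + 1 then p x
      else if x = y + 1 then q x
      else if y = x then 1 - p x - q x
      else 0)"

definition gamblers_ruin ::
    "'a measure \<Rightarrow> nat \<Rightarrow> (nat \<Rightarrow> real) \<Rightarrow> (nat \<Rightarrow> real) \<Rightarrow> (nat \<Rightarrow> 'a \<Rightarrow> nat) \<Rightarrow> bool" where
  "gamblers_ruin M N p q X \<longleftrightarrow> markov_chain M {0..N} (gr_trans p q) X"

text \<open>The first time the path \<open>\<omega>\<close> is in \<open>A\<close>; it is \<open>\<infinity> = Inf {}\<close> if that never happens.\<close>
definition hitting_time :: "(nat \<Rightarrow> 'a \<Rightarrow> 's) \<Rightarrow> 's set \<Rightarrow> 'a \<Rightarrow> enat" where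
  "hitting_time X A \<omega> = Inf {enat n | n. X n \<omega> \<in> A}"

definition rho :: "'a measure \<Rightarrow> (nat \<Rightarrow> 'a \<Rightarrow> nat) \<Rightarrow> nat \<Rightarrow> nat \<Rightarrow> nat \<Rightarrow> real" where
  "rho M X j i k = \<P>(\<omega> in M. hitting_time X {k} \<omega> < hitting_time X {j} \<omega> \<bar> X 0 \<omega> = i)"

text \<open>
  \<open>E T\<^bsub>j:i:k\<^esub>\<close>: \<open>uniform_measure M B\<close> is \<open>M\<close> conditioned on the event \<open>B\<close>. The value is extended
  real, since the hitting time may a priori be infinite or have infinite mean.
\<close>
definition expected_T :: "'a measure \<Rightarrow> (nat \<Rightarrow> 'a \<Rightarrow> nat) \<Rightarrow> nat \<Rightarrow> nat \<Rightarrow> nat \<Rightarrow> ereal" where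
  "expected_T M X j i k =
     enn2ereal (\<integral>\<^sup>+ \<omega>. ennreal_of_enat (hitting_time X {j, k} \<omega>)
       \<partial>uniform_measure M {\<omega> \<in> space M. X 0 \<omega> = i})"

definition lw_ratio :: "(nat \<Rightarrow> real) \<Rightarrow> (nat \<Rightarrow> real) \<Rightarrow> nat \<Rightarrow> real" where
  "lw_ratio p q s = q s / p s"

definition d_prod :: "(nat \<Rightarrow> real) \<Rightarrow> nat \<Rightarrow> nat \<Rightarrow> real" where
  "d_prod r j s = (\<Prod>l = j + 1..s. r l)"

end

theory Submission
  imports Defs
begin

text \<open>
  Stop the chain when it first enters \<open>{j, k}\<close> and let \<open>\<mu> n x\<close> be the probability that it starts in
  \<open>i\<close> and that the stopped chain is in \<open>x\<close> at time \<open>n\<close>. If \<open>f\<close> solves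
  \<open>p x * (f (x + 1) - f x) - q x * (f x - f (x - 1)) = - c\<close> strictly between \<open>j\<close> and \<open>k\<close>, then the
  \<open>\<mu> n\<close>-integral of \<open>f\<close> plus \<open>c\<close> times the interior mass accumulated before time \<open>n\<close> does not
  depend on \<open>n\<close>. The solution with \<open>c = 1\<close> vanishing at \<open>j\<close> and \<open>k\<close> is bounded, so the interior
  masses \<open>P (T > n)\<close> are summable. Hence they tend to \<open>0\<close>, which kills the boundary term and
  identifies their sum, the mean of \<open>T\<close>; no separate estimate of the absorption time is needed. The
  solution with \<open>c = 0\<close>, \<open>f j = 0\<close> and \<open>f k = 1\<close> then gives the probability of absorption in \<open>k\<close>.
\<close>

section \<open>Stopped paths and hitting times\<close>

text \<open>Freezing acts on a single path rather than on the process, so that a statement about the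
  stopped chain at time \<open>n\<close> is visibly a predicate of the path up to time
  \<open>n\<close>, the form in which the Markov property is applied below.\<close>

primrec stopped :: "'s set \<Rightarrow> (nat \<Rightarrow> 's) \<Rightarrow> nat \<Rightarrow> 's" where
  "stopped A w 0 = w 0"
| "stopped A w (Suc n) = (if stopped A w n \<in> A then stopped A w n else w (Suc n))"

lemma stopped_cong: "(\<And>m. m \<le> n \<Longrightarrow> v m = w m) \<Longrightarrow> stopped A v n = stopped A w n"
  by (induction n) auto

lemma stopped_in_iff: "stopped A w n \<in> A \<longleftrightarrow> (\<exists>m\<le>n. w m \<in> A)"
  by (induction n) (auto simp: le_Suc_eq)

lemma stopped_notin: "stopped A w n \<notin> A \<Longrightarrow> stopped A w n = w n"
  by (cases n) (auto split: if_splits)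

text \<open>A frozen value never changes, so a value in \<open>A\<close> can only come from the
  first entry into \<open>A\<close>. This reads off where the path enters, whereas
  \<open>stopped_in_iff\<close> only tells whether it does.\<close>

lemma stopped_eq_iff:
  assumes "y \<in> A"
  shows "stopped A w n = y \<longleftrightarrow> (\<exists>m\<le>n. w m = y \<and> (\<forall>l<m. w l \<notin> A))"
proof (induction n)
  case (Suc n)
  show ?case
  proof (cases "stopped A w n \<in> A")
    case True
    then obtain m where "m \<le> n" "w m \<in> A"
      by (auto simp: stopped_in_iff)
    then have "\<not> (\<forall>l<Suc n. w l \<notin> A)"
      by (auto simp: less_Suc_eq_le)
    with True Suc show ?thesis
      by (auto simp: le_Suc_eq)
  next
    case False
    then have "\<forall>m\<le>n. w m \<notin> A"
      by (auto simp: stopped_in_iff)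
    with False assms show ?thesis
      by (auto simp: le_Suc_eq less_Suc_eq_le)
  qed
qed auto

lemma le_hitting_time_iff: "enat n \<le> hitting_time X A \<omega> \<longleftrightarrow> (\<forall>m<n. X m \<omega> \<notin> A)"
proof -
  have "enat n \<le> hitting_time X A \<omega> \<longleftrightarrow> (\<forall>m. X m \<omega> \<in> A \<longrightarrow> n \<le> m)"
    by (auto simp: hitting_time_def le_Inf_iff)
  also have "\<dots> \<longleftrightarrow> (\<forall>m<n. X m \<omega> \<notin> A)"
    by (metis not_le)
  finally show ?thesis .
qed

lemma less_hitting_time_iff: "enat n < hitting_time X A \<omega> \<longleftrightarrow> (\<forall>m\<le>n. X m \<omega> \<notin> A)"
  using le_hitting_time_iff[of "Suc n" X A \<omega>] by (simp add: Suc_ile_eq less_Suc_eq_le)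

lemma less_hitting_time_iff_stopped:
  "enat n < hitting_time X A \<omega> \<longleftrightarrow> stopped A (\<lambda>m. X m \<omega>) n \<notin> A"
  by (simp add: less_hitting_time_iff stopped_in_iff)

text \<open>The strict inequality forces the time of \<open>k\<close> to be finite, and then the
  first entry into \<open>{j, k}\<close> happens at \<open>k\<close>. Paths that visit neither point
  satisfy neither side.\<close>

lemma hitting_time_less_iff_stopped:
  assumes "j \<noteq> k"
  shows "hitting_time X {k} \<omega> < hitting_time X {j} \<omega> \<longleftrightarrow>
    (\<exists>n. stopped {j, k} (\<lambda>m. X m \<omega>) n = k)"
proof
  assume less: "hitting_time X {k} \<omega> < hitting_time X {j} \<omega>"
  then obtain n where "hitting_time X {k} \<omega> = enat n"
    by (cases "hitting_time X {k} \<omega>") auto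
  then have "\<not> enat n < hitting_time X {k} \<omega>"
    by simp
  then have ex: "\<exists>n. X n \<omega> = k"
    by (auto simp: less_hitting_time_iff)
  define m where "m = (LEAST m. X m \<omega> = k)"
  have m: "X m \<omega> = k" and least: "\<forall>l<m. X l \<omega> \<noteq> k"
    using LeastI_ex[OF ex] not_less_Least by (auto simp: m_def)
  have "enat m \<le> hitting_time X {k} \<omega>"
    using least by (simp add: le_hitting_time_iff)
  with less have "enat m < hitting_time X {j} \<omega>"
    by simp
  then have "\<forall>l\<le>m. X l \<omega> \<noteq> j"
    by (simp add: less_hitting_time_iff)
  with m least have "X m \<omega> = k \<and> (\<forall>l<m. X l \<omega> \<notin> {j, k})"
    by simp
  then have "stopped {j, k} (\<lambda>m. X m \<omega>) m = k"
    by (subst stopped_eq_iff) blast+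
  then show "\<exists>n. stopped {j, k} (\<lambda>m. X m \<omega>) n = k" ..
next
  assume "\<exists>n. stopped {j, k} (\<lambda>m. X m \<omega>) n = k"
  then obtain m where m: "X m \<omega> = k" "\<forall>l<m. X l \<omega> \<notin> {j, k}"
    by (auto simp: stopped_eq_iff)
  then have "enat m < hitting_time X {j} \<omega>"
    using assms by (auto simp: less_hitting_time_iff le_less)
  moreover have "hitting_time X {k} \<omega> \<le> enat m"
    using m less_hitting_time_iff[of m X "{k}" \<omega>] by (auto simp: not_less)
  ultimately show "hitting_time X {k} \<omega> < hitting_time X {j} \<omega>"
    by (rule le_less_trans[rotated])
qed

section \<open>Measurability and the Markov property for events of the past\<close>

lemma markov_chain_measurable:
  assumes "markov_chain M S K X"
  shows "X n \<in> measurable M (count_space UNIV)"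
  using assms measurable_compose[of "X n" M "count_space S" "\<lambda>x. x" "count_space UNIV"]
  by (auto simp: markov_chain_def)

lemma markov_chain_in_space:
  assumes "markov_chain M S K X" "\<omega> \<in> space M"
  shows "X n \<omega> \<in> S"
  using assms measurable_space[of "X n" M "count_space S" \<omega>] by (auto simp: markov_chain_def)

lemma markov_chain_stopped_measurable:
  assumes "markov_chain M S K X"
  shows "(\<lambda>\<omega>. stopped A (\<lambda>m. X m \<omega>) n) \<in> measurable M (count_space UNIV)"
proof (induction n)
  case 0
  show ?case
    using markov_chain_measurable[OF assms] by simp
next
  case (Suc n)
  note [measurable] = Suc markov_chain_measurable[OF assms]
  have [measurable]: "Measurable.pred M (\<lambda>\<omega>. stopped A (\<lambda>m. X m \<omega>) n \<in> A)"
    using measurable_compose[OF Suc, of "\<lambda>x. x \<in> A" "count_space UNIV"] by simp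
  show ?case
    unfolding stopped.simps by measurable
qed

text \<open>The infimum is rewritten as a \<open>LEAST\<close> guarded by a case distinction, since
  \<open>LEAST\<close> over a countable family of measurable predicates is measurable.\<close>

lemma markov_chain_hitting_time_measurable:
  assumes "markov_chain M S K X"
  shows "hitting_time X A \<in> measurable M (count_space UNIV)"
proof -
  have [measurable]: "Measurable.pred M (\<lambda>\<omega>. X n \<omega> \<in> A)" for n
    using measurable_compose[OF markov_chain_measurable[OF assms], of "\<lambda>x. x \<in> A" "count_space UNIV"]
    by simp
  have eq: "hitting_time X A \<omega> =
      (if \<exists>n. X n \<omega> \<in> A then enat (LEAST n. X n \<omega> \<in> A) else \<infinity>)" for \<omega>
  proof (cases "\<exists>n. X n \<omega> \<in> A")
    case True
    have "hitting_time X A \<omega> = enat (LEAST n. X n \<omega> \<in> A)"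
      unfolding hitting_time_def
      using LeastI_ex[OF True] by (intro antisym Inf_lower Inf_greatest) (auto intro: Least_le)
    with True show ?thesis
      by simp
  next
    case False
    then show ?thesis
      by (simp add: hitting_time_def top_enat_def)
  qed
  have "(\<lambda>\<omega>. if \<exists>n. X n \<omega> \<in> A then enat (LEAST n. X n \<omega> \<in> A) else \<infinity>)
      \<in> measurable M (count_space UNIV)"
  proof (rule measurable_If)
    show "(\<lambda>\<omega>. enat (LEAST n. X n \<omega> \<in> A)) \<in> measurable M (count_space UNIV)"
      by measurable
  qed simp_all
  then show ?thesis
    by (simp add: eq[symmetric] cong: measurable_cong)
qed

text \<open>The definition of the chain conditions on one complete trajectory. As \<open>S\<close>
  is finite, an event determined by the path up to time \<open>n\<close> is a finite disjoint union
  of such cylinders, and each of them that ends in \<open>x\<close> contributes the same factor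
  \<open>K x y\<close>.\<close>

lemma markov_chain_step:
  assumes mc: "markov_chain M S K X" and "finite S"
    and past: "\<And>v w. (\<And>m. m \<le> n \<Longrightarrow> v m = w m) \<Longrightarrow> P v = P w"
    and "y \<in> S"
  shows "measure M {\<omega> \<in> space M. P (\<lambda>m. X m \<omega>) \<and> X n \<omega> = x \<and> X (Suc n) \<omega> = y} =
    measure M {\<omega> \<in> space M. P (\<lambda>m. X m \<omega>) \<and> X n \<omega> = x} * K x y"
proof -
  interpret prob_space M
    using mc by (simp add: markov_chain_def)
  note [measurable] = markov_chain_measurable[OF mc]
  \<comment> \<open>Extensional functions on \<open>{..n}\<close> make the index set finite and let
    distinct indices differ at some time \<open>m \<le> n\<close>, so that their cylinders are
    disjoint.\<close>
  define W where "W = {w \<in> {..n} \<rightarrow>\<^sub>E S. P w \<and> w n = x}"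
  define C where "C w = {\<omega> \<in> space M. \<forall>m\<le>n. X m \<omega> = w m}" for w
  have fin: "finite W"
    unfolding W_def using \<open>finite S\<close> by (intro finite_subset[OF _ finite_PiE[of "{..n}" "\<lambda>_. S"]]) auto
  have path: "P (\<lambda>m. X m \<omega>) \<and> X n \<omega> = x \<longleftrightarrow> (\<exists>w\<in>W. \<omega> \<in> C w)" if "\<omega> \<in> space M" for \<omega>
  proof
    assume "P (\<lambda>m. X m \<omega>) \<and> X n \<omega> = x"
    moreover have "P (restrict (\<lambda>m. X m \<omega>) {..n}) = P (\<lambda>m. X m \<omega>)"
      by (rule past) auto
    ultimately have "restrict (\<lambda>m. X m \<omega>) {..n} \<in> W"
      using markov_chain_in_space[OF mc that] by (auto simp: W_def)
    with that show "\<exists>w\<in>W. \<omega> \<in> C w"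
      by (intro bexI[of _ "restrict (\<lambda>m. X m \<omega>) {..n}"]) (auto simp: C_def)
  next
    assume "\<exists>w\<in>W. \<omega> \<in> C w"
    then obtain w where w: "w \<in> W" "\<omega> \<in> C w"
      by blast
    then have "P (\<lambda>m. X m \<omega>) = P w"
      by (intro past) (auto simp: C_def)
    with w show "P (\<lambda>m. X m \<omega>) \<and> X n \<omega> = x"
      by (auto simp: W_def C_def)
  qed
  have disj: "disjoint_family_on C W"
    unfolding disjoint_family_on_def
  proof (intro ballI impI)
    fix v w assume vw: "v \<in> W" "w \<in> W" "v \<noteq> w"
    then obtain m where "m \<le> n" "v m \<noteq> w m"
      by (auto simp: W_def dest: PiE_ext)
    then show "C v \<inter> C w = {}"
      by (auto simp: C_def)
  qed
  have step: "prob (C w \<inter> {\<omega> \<in> space M. X (Suc n) \<omega> = y}) = prob (C w) * K x y" if "w \<in> W" for w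
  proof (cases "prob (C w) = 0")
    \<comment> \<open>The definition says nothing about null cylinders; for them both sides are
      0.\<close>
    case True
    have "prob (C w \<inter> {\<omega> \<in> space M. X (Suc n) \<omega> = y}) \<le> prob (C w)"
      by (rule finite_measure_mono) (auto simp: C_def)
    with True show ?thesis
      by (simp add: antisym)
  next
    case False
    then have pos: "0 < prob (C w)"
      by (simp add: zero_less_measure_iff)
    have w: "\<forall>m\<le>n. w m \<in> S" "w n = x"
      using that by (auto simp: W_def)
    have "\<P>(\<omega> in M. X (Suc n) \<omega> = y \<bar> \<forall>m\<le>n. X m \<omega> = w m) = K (w n) y"
      using mc pos w(1) \<open>y \<in> S\<close> unfolding markov_chain_def C_def by blast
    with w have "\<P>(\<omega> in M. X (Suc n) \<omega> = y \<bar> \<forall>m\<le>n. X m \<omega> = w m) = K x y"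
      by simp
    moreover have "C w \<inter> {\<omega> \<in> space M. X (Suc n) \<omega> = y} =
        {\<omega> \<in> space M. X (Suc n) \<omega> = y \<and> (\<forall>m\<le>n. X m \<omega> = w m)}"
      by (auto simp: C_def)
    ultimately show ?thesis
      using pos by (simp add: cond_prob_def C_def field_simps)
  qed
  have "measure M {\<omega> \<in> space M. P (\<lambda>m. X m \<omega>) \<and> X n \<omega> = x \<and> X (Suc n) \<omega> = y} =
      prob (\<Union>w\<in>W. C w \<inter> {\<omega> \<in> space M. X (Suc n) \<omega> = y})"
    using path by (intro arg_cong[where f = prob]) (auto simp: C_def)
  also have "\<dots> = (\<Sum>w\<in>W. prob (C w \<inter> {\<omega> \<in> space M. X (Suc n) \<omega> = y}))"
    using fin disj
    by (intro finite_measure_finite_Union) (auto simp: C_def disjoint_family_on_def)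
  also have "\<dots> = (\<Sum>w\<in>W. prob (C w)) * K x y"
    by (simp add: step sum_distrib_right)
  also have "(\<Sum>w\<in>W. prob (C w)) = prob (\<Union>w\<in>W. C w)"
    using fin disj by (intro finite_measure_finite_Union[symmetric]) (auto simp: C_def[abs_def])
  also have "(\<Union>w\<in>W. C w) = {\<omega> \<in> space M. P (\<lambda>m. X m \<omega>) \<and> X n \<omega> = x}"
    using path by (auto simp: C_def)
  finally show ?thesis .
qed

section \<open>Evolution of the stopped chain\<close>

text \<open>A joint probability with \<open>X 0 = i\<close>, not a conditional one: the total mass
  is the probability of that start, and the normalisation is postponed to the very end.\<close>

definition stopped_law :: "'a measure \<Rightarrow> (nat \<Rightarrow> 'a \<Rightarrow> 's) \<Rightarrow> 's set \<Rightarrow> 's \<Rightarrow> nat \<Rightarrow> 's \<Rightarrow> real" where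
  "stopped_law M X A i n x =
    measure M {\<omega> \<in> space M. X 0 \<omega> = i \<and> stopped A (\<lambda>m. X m \<omega>) n = x}"

lemma stopped_law_nonneg: "0 \<le> stopped_law M X A i n x"
  by (simp add: stopped_law_def)

lemma markov_chain_stopped_in_space:
  assumes "markov_chain M S K X" "\<omega> \<in> space M"
  shows "stopped A (\<lambda>m. X m \<omega>) n \<in> S"
  by (induction n) (auto simp: markov_chain_in_space[OF assms])

text \<open>The evolution is stated in dual form: one time step of the law is moved onto the test
  function \<open>f\<close>, where it acts as the identity on \<open>A\<close> and as the kernel
  \<open>K\<close> off \<open>A\<close>.\<close>

lemma stopped_law_step:
  fixes f :: "'s \<Rightarrow> real" and A :: "'s set" and i :: 's
  assumes mc: "markov_chain M S K X" and fin: "finite S"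
  defines "\<mu> \<equiv> stopped_law M X A i"
  shows "(\<Sum>y\<in>S. f y * \<mu> (Suc n) y) =
    (\<Sum>x\<in>S. (if x \<in> A then f x else \<Sum>y\<in>S. K x y * f y) * \<mu> n x)"
proof -
  interpret prob_space M
    using mc by (simp add: markov_chain_def)
  note [measurable] = markov_chain_measurable[OF mc] markov_chain_stopped_measurable[OF mc]
  let ?Y = "\<lambda>n \<omega>. stopped A (\<lambda>m. X m \<omega>) n"
  define J where "J x y = {\<omega> \<in> space M. X 0 \<omega> = i \<and> ?Y n \<omega> = x \<and> ?Y (Suc n) \<omega> = y}" for x y
  note Y_in = markov_chain_stopped_in_space[OF mc]
  have split: "\<mu> (Suc n) y = (\<Sum>x\<in>S. prob (J x y))" for y
  proof -
    have "{\<omega> \<in> space M. X 0 \<omega> = i \<and> ?Y (Suc n) \<omega> = y} = (\<Union>x\<in>S. J x y)"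
      using Y_in by (auto simp: J_def simp del: stopped.simps)
    then show ?thesis
      unfolding \<mu>_def stopped_law_def using fin
      by (simp del: stopped.simps, intro finite_measure_finite_Union)
        (auto simp: J_def disjoint_family_on_def simp del: stopped.simps)
  qed
  have J: "prob (J x y) = (if x \<in> A then if y = x then 1 else 0 else K x y) * \<mu> n x" if "y \<in> S" for x y
  proof (cases "x \<in> A")
    case True
    then have "J x y = (if y = x then {\<omega> \<in> space M. X 0 \<omega> = i \<and> ?Y n \<omega> = x} else {})"
      by (auto simp: J_def)
    with True show ?thesis
      by (simp add: \<mu>_def stopped_law_def)
  next
    case False
    let ?P = "\<lambda>w. w 0 = i \<and> stopped A w n = x"
    have "J x y = {\<omega> \<in> space M. ?P (\<lambda>m. X m \<omega>) \<and> X n \<omega> = x \<and> X (Suc n) \<omega> = y}"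
      using False stopped_notin[of A] by (fastforce simp: J_def)
    moreover have "prob \<dots> = prob {\<omega> \<in> space M. ?P (\<lambda>m. X m \<omega>) \<and> X n \<omega> = x} * K x y"
    proof (rule markov_chain_step[OF mc fin _ that])
      fix v w :: "nat \<Rightarrow> 's" assume eq: "\<And>m. m \<le> n \<Longrightarrow> v m = w m"
      show "?P v = ?P w"
        using eq[of 0] stopped_cong[of n v w A, OF eq] by simp
    qed
    moreover have "{\<omega> \<in> space M. ?P (\<lambda>m. X m \<omega>) \<and> X n \<omega> = x} = {\<omega> \<in> space M. ?P (\<lambda>m. X m \<omega>)}"
      using False stopped_notin[of A] by fastforce
    ultimately show ?thesis
      using False by (simp add: \<mu>_def stopped_law_def)
  qed
  have "(\<Sum>y\<in>S. f y * \<mu> (Suc n) y) = (\<Sum>x\<in>S. \<Sum>y\<in>S. f y * prob (J x y))"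
    by (subst sum.swap) (simp add: split sum_distrib_left)
  also have "\<dots> = (\<Sum>x\<in>S. (if x \<in> A then f x else \<Sum>y\<in>S. K x y * f y) * \<mu> n x)"
  proof (intro sum.cong refl)
    fix x assume "x \<in> S"
    have "(\<Sum>y\<in>S. f y * prob (J x y)) =
        (\<Sum>y\<in>S. (if x \<in> A then if y = x then f x else 0 else K x y * f y) * \<mu> n x)"
      by (intro sum.cong refl) (simp add: J)
    also have "\<dots> = (\<Sum>y\<in>S. if x \<in> A then if y = x then f x else 0 else K x y * f y) * \<mu> n x"
      by (simp add: sum_distrib_right)
    also have "(\<Sum>y\<in>S. if x \<in> A then if y = x then f x else 0 else K x y * f y) =
        (if x \<in> A then f x else \<Sum>y\<in>S. K x y * f y)"
      using \<open>x \<in> S\<close> fin by simp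
    finally show "(\<Sum>y\<in>S. f y * prob (J x y)) =
        (if x \<in> A then f x else \<Sum>y\<in>S. K x y * f y) * \<mu> n x" .
  qed
  finally show ?thesis .
qed

section \<open>Harmonic analysis of the gambler's ruin chain\<close>

lemma sum_gr_trans:
  fixes f :: "nat \<Rightarrow> real"
  assumes "0 < x" "x < N"
  shows "(\<Sum>y\<in>{0..N}. gr_trans p q x y * f y) =
    f x + p x * (f (x + 1) - f x) - q x * (f x - f (x - 1))"
proof -
  have "(\<Sum>y\<in>{0..N}. gr_trans p q x y * f y) = (\<Sum>y\<in>{x - 1, x, x + 1}. gr_trans p q x y * f y)"
    using assms by (intro sum.mono_neutral_right) (auto simp: gr_trans_def)
  also have "\<dots> = f x + p x * (f (x + 1) - f x) - q x * (f x - f (x - 1))"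
  proof -
    \<comment> \<open>Subtraction on naturals is truncated; \<open>0 < x\<close> makes the three
      neighbours distinct and lets the losing branch of \<open>gr_trans\<close> match.\<close>
    have "x - 1 \<noteq> x" "x - 1 \<noteq> x + 1" "x \<noteq> x + 1" "x = x - 1 + 1"
      using assms by auto
    then show ?thesis
      by (simp add: gr_trans_def algebra_simps)
  qed
  finally show ?thesis .
qed

lemma measure_stopped_notin:
  assumes mc: "markov_chain M S K X" and "finite S"
  shows "measure M {\<omega> \<in> space M. X 0 \<omega> = i \<and> stopped A (\<lambda>m. X m \<omega>) n \<notin> A} =
    (\<Sum>x\<in>S - A. stopped_law M X A i n x)"
proof -
  interpret prob_space M
    using mc by (simp add: markov_chain_def)
  note [measurable] = markov_chain_measurable[OF mc] markov_chain_stopped_measurable[OF mc]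
  have "{\<omega> \<in> space M. X 0 \<omega> = i \<and> stopped A (\<lambda>m. X m \<omega>) n \<notin> A} =
      (\<Union>x\<in>S - A. {\<omega> \<in> space M. X 0 \<omega> = i \<and> stopped A (\<lambda>m. X m \<omega>) n = x})"
    using markov_chain_stopped_in_space[OF mc] by auto
  then show ?thesis
    unfolding stopped_law_def using \<open>finite S\<close>
    by (simp, intro finite_measure_finite_Union) (auto simp: disjoint_family_on_def)
qed

text \<open>Steps to nearest neighbours cannot leave \<open>{j..k}\<close> without passing through
  \<open>j\<close> or \<open>k\<close>, where the stopped chain stays.\<close>

lemma gamblers_ruin_stopped_law_outside:
  assumes gr: "gamblers_ruin M N p q X" and "i \<in> {j..k}" "k \<le> N" and "x \<in> {0..N} - {j..k}"
  shows "stopped_law M X {j, k} i n x = 0"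
  using \<open>x \<in> {0..N} - {j..k}\<close>
proof (induction n arbitrary: x)
  case 0
  then have "{\<omega> \<in> space M. X 0 \<omega> = i \<and> X 0 \<omega> = x} = {}"
    using \<open>i \<in> {j..k}\<close> by auto
  then show ?case
    by (simp only: stopped_law_def stopped.simps measure_empty)
next
  case (Suc n)
  define f :: "nat \<Rightarrow> real" where "f y = (if y = x then 1 else 0)" for y
  have "stopped_law M X {j, k} i (Suc n) x = (\<Sum>y\<in>{0..N}. f y * stopped_law M X {j, k} i (Suc n) y)"
    using Suc.prems by (simp add: f_def if_distrib[of "\<lambda>a. a * _"] cong: if_cong)
  also have "\<dots> = (\<Sum>y\<in>{0..N}. (if y \<in> {j, k} then f y else \<Sum>z\<in>{0..N}. gr_trans p q y z * f z)
      * stopped_law M X {j, k} i n y)"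
    using gr by (intro stopped_law_step) (auto simp: gamblers_ruin_def)
  also have "\<dots> = 0"
  proof (intro sum.neutral ballI)
    fix y assume y: "y \<in> {0..N}"
    consider "y \<in> {j, k}" | "j < y" "y < k" | "y \<in> {0..N} - {j..k}"
      using y by fastforce
    then show "(if y \<in> {j, k} then f y else \<Sum>z\<in>{0..N}. gr_trans p q y z * f z)
        * stopped_law M X {j, k} i n y = 0"
    proof cases
      case 1
      then show ?thesis
        using Suc.prems assms(2) by (auto simp: f_def)
    next
      case 2
      then have "f y = 0" "f (y + 1) = 0" "f (y - 1) = 0"
        using Suc.prems by (auto simp: f_def)
      with 2 \<open>k \<le> N\<close> show ?thesis
        by (simp only: sum_gr_trans[of y N]) auto
    next
      case 3
      then show ?thesis
        using Suc.IH by simp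
    qed
  qed
  finally show ?case .
qed

text \<open>Dynkin's formula for the stopped chain: each step lowers the integral of
  \<open>f\<close> by \<open>c\<close> times the current interior mass, while mass at
  \<open>j\<close> and \<open>k\<close> contributes no change.\<close>

lemma gamblers_ruin_dynkin:
  fixes f :: "nat \<Rightarrow> real"
  assumes gr: "gamblers_ruin M N p q X" and i: "i \<in> {j..k}" and "k \<le> N"
    and f: "\<And>x. j < x \<Longrightarrow> x < k \<Longrightarrow> p x * (f (x + 1) - f x) - q x * (f x - f (x - 1)) = - c"
  defines "\<mu> \<equiv> stopped_law M X {j, k} i"
  shows "(\<Sum>x\<in>{j..k}. f x * \<mu> n x) + c * (\<Sum>m<n. \<Sum>x\<in>{j<..<k}. \<mu> m x) =
    f i * \<P>(\<omega> in M. X 0 \<omega> = i)"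
proof (induction n)
  case 0
  have "\<mu> 0 x = (if x = i then \<P>(\<omega> in M. X 0 \<omega> = i) else 0)" for x
  proof (cases "x = i")
    case False
    then have "{\<omega> \<in> space M. X 0 \<omega> = i \<and> X 0 \<omega> = x} = {}"
      by auto
    with False show ?thesis
      by (simp only: \<mu>_def stopped_law_def stopped.simps measure_empty if_False)
  qed (simp add: \<mu>_def stopped_law_def)
  then show ?case
    using i by (simp add: if_distrib[of "\<lambda>a. _ * a"] cong: if_cong)
next
  case (Suc n)
  have outside: "(\<Sum>x\<in>{0..N}. g x * \<mu> m x) = (\<Sum>x\<in>{j..k}. g x * \<mu> m x)" for g m
    using gamblers_ruin_stopped_law_outside[OF gr i \<open>k \<le> N\<close>] \<open>k \<le> N\<close>
    by (intro sum.mono_neutral_right) (auto simp: \<mu>_def)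
  have "(\<Sum>x\<in>{j..k}. f x * \<mu> (Suc n) x) =
      (\<Sum>x\<in>{j..k}. (if x \<in> {j, k} then f x else \<Sum>y\<in>{0..N}. gr_trans p q x y * f y) * \<mu> n x)"
    unfolding outside[symmetric] unfolding \<mu>_def
    using gr by (intro stopped_law_step) (auto simp: gamblers_ruin_def)
  also have "\<dots> = (\<Sum>x\<in>{j..k}. f x * \<mu> n x - (if x \<in> {j<..<k} then c * \<mu> n x else 0))"
  proof (intro sum.cong refl)
    fix x assume x: "x \<in> {j..k}"
    show "(if x \<in> {j, k} then f x else \<Sum>y\<in>{0..N}. gr_trans p q x y * f y) * \<mu> n x =
        f x * \<mu> n x - (if x \<in> {j<..<k} then c * \<mu> n x else 0)"
    proof (cases "x \<in> {j, k}")
      case False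
      with x have "j < x" "x < k"
        by auto
      then have "(\<Sum>y\<in>{0..N}. gr_trans p q x y * f y) = f x - c"
        using sum_gr_trans[of x N p q f] f[of x] \<open>k \<le> N\<close> by simp
      with False \<open>j < x\<close> \<open>x < k\<close> show ?thesis
        by (simp add: left_diff_distrib)
    qed auto
  qed
  also have "\<dots> = (\<Sum>x\<in>{j..k}. f x * \<mu> n x) - (\<Sum>x\<in>{j..k} \<inter> {j<..<k}. c * \<mu> n x)"
    by (simp only: sum_subtractf sum.inter_restrict[OF finite_atLeastAtMost])
  also have "{j..k} \<inter> {j<..<k} = {j<..<k}"
    by auto
  finally show ?case
    using Suc by (simp add: sum_distrib_left algebra_simps)
qed

text \<open>The remainder bound \<open>R_le\<close> is used twice: with \<open>s n \<le> 1\<close>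
  it bounds the partial sums, and once summability gives that \<open>s\<close> tends to 0, it
  removes the remainder from the limit.\<close>

lemma gamblers_ruin_occupation_sums:
  fixes h :: "nat \<Rightarrow> real"
  assumes gr: "gamblers_ruin M N p q X" and i: "i \<in> {j..k}" and "k \<le> N"
    and h: "\<And>x. j < x \<Longrightarrow> x < k \<Longrightarrow> p x * (h (x + 1) - h x) - q x * (h x - h (x - 1)) = - 1"
    and "h j = 0" "h k = 0"
  shows "(\<lambda>n. \<Sum>x\<in>{j<..<k}. stopped_law M X {j, k} i n x) sums (h i * \<P>(\<omega> in M. X 0 \<omega> = i))"
proof -
  interpret prob_space M
    using gr by (simp add: gamblers_ruin_def markov_chain_def)
  let ?\<mu> = "stopped_law M X {j, k} i" and ?P = "\<P>(\<omega> in M. X 0 \<omega> = i)"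
  define s where "s n = (\<Sum>x\<in>{j<..<k}. ?\<mu> n x)" for n
  define B where "B = (\<Sum>x\<in>{j..k}. \<bar>h x\<bar>)"
  define R where "R n = (\<Sum>x\<in>{j..k}. h x * ?\<mu> n x)" for n
  have s_nonneg: "0 \<le> s n" for n
    by (simp add: s_def sum_nonneg stopped_law_nonneg)
  have s_le: "s n \<le> 1" for n
  proof -
    have "s n \<le> (\<Sum>x\<in>{j..k}. ?\<mu> n x)"
      by (auto simp: s_def stopped_law_nonneg intro!: sum_mono2)
    \<comment> \<open>Conservation of mass: Dynkin's formula for the constant 1 with
      \<open>c = 0\<close>.\<close>
    also have "\<dots> = ?P"
      using gamblers_ruin_dynkin[OF gr i \<open>k \<le> N\<close>, of "\<lambda>_. 1" 0 n] by simp
    also have "\<dots> \<le> 1"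
      by (rule prob_le_1)
    finally show ?thesis .
  qed
  have B_nonneg: "0 \<le> B"
    by (simp add: B_def sum_nonneg)
  \<comment> \<open>As \<open>h\<close> vanishes at both ends, only interior mass enters the
    remainder.\<close>
  have R_le: "\<bar>R n\<bar> \<le> B * s n" for n
  proof -
    have "R n = (\<Sum>x\<in>{j<..<k}. h x * ?\<mu> n x)"
      unfolding R_def using \<open>h j = 0\<close> \<open>h k = 0\<close>
      by (intro sum.mono_neutral_right) (auto simp: le_less)
    also have "\<bar>\<dots>\<bar> \<le> (\<Sum>x\<in>{j<..<k}. \<bar>h x * ?\<mu> n x\<bar>)"
      by (rule sum_abs)
    also have "\<dots> \<le> (\<Sum>x\<in>{j<..<k}. B * ?\<mu> n x)"
    proof (intro sum_mono)
      fix x assume "x \<in> {j<..<k}"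
      then have "\<bar>h x\<bar> \<le> B"
        unfolding B_def by (intro member_le_sum) auto
      then show "\<bar>h x * ?\<mu> n x\<bar> \<le> B * ?\<mu> n x"
        by (simp add: abs_mult stopped_law_nonneg mult_right_mono)
    qed
    finally show ?thesis
      by (simp add: s_def sum_distrib_left)
  qed
  have partial: "(\<Sum>m<n. s m) = h i * ?P - R n" for n
    using gamblers_ruin_dynkin[OF gr i \<open>k \<le> N\<close>, of h 1 n] h by (simp add: s_def R_def)
  have "(\<Sum>m<n. s m) \<le> h i * ?P + B" for n
    using partial[of n] R_le[of n] mult_left_mono[OF s_le[of n] B_nonneg] by linarith
  then have "summable s"
    using s_nonneg by (intro summableI_nonneg_bounded) auto
  then have "(\<lambda>n. B * s n) \<longlonglongrightarrow> 0"
    by (intro tendsto_mult_right_zero summable_LIMSEQ_zero)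
  then have "R \<longlonglongrightarrow> 0"
    by (rule Lim_null_comparison[rotated]) (simp add: R_le)
  then have "(\<lambda>n. h i * ?P - R n) \<longlonglongrightarrow> h i * ?P - 0"
    by (intro tendsto_intros)
  then have "s sums (h i * ?P)"
    by (simp add: sums_def partial)
  then show ?thesis
    by (simp add: s_def[abs_def])
qed

text \<open>For harmonic \<open>g\<close> the integral is constant in time. Its part at
  \<open>j\<close> is 0 and its interior part dies out, so all of it ends up at
  \<open>k\<close>.\<close>

lemma gamblers_ruin_absorption_limit:
  fixes g :: "nat \<Rightarrow> real"
  assumes gr: "gamblers_ruin M N p q X" and i: "i \<in> {j..k}" and "k \<le> N" and "j < k"
    and g: "\<And>x. j < x \<Longrightarrow> x < k \<Longrightarrow> p x * (g (x + 1) - g x) - q x * (g x - g (x - 1)) = 0"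
    and "g j = 0" "g k = 1"
    and null: "(\<lambda>n. \<Sum>x\<in>{j<..<k}. stopped_law M X {j, k} i n x) \<longlonglongrightarrow> 0"
  shows "(\<lambda>n. stopped_law M X {j, k} i n k) \<longlonglongrightarrow> g i * \<P>(\<omega> in M. X 0 \<omega> = i)"
proof -
  let ?\<mu> = "stopped_law M X {j, k} i"
  have \<mu>_lim: "(\<lambda>n. ?\<mu> n x) \<longlonglongrightarrow> 0" if "x \<in> {j<..<k}" for x
  proof (rule Lim_null_comparison[OF _ null])
    have "norm (?\<mu> n x) \<le> (\<Sum>x\<in>{j<..<k}. ?\<mu> n x)" for n
      using that member_le_sum[of x "{j<..<k}" "?\<mu> n"] by (simp add: stopped_law_nonneg)
    then show "\<forall>\<^sub>F n in sequentially. norm (?\<mu> n x) \<le> (\<Sum>x\<in>{j<..<k}. ?\<mu> n x)"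
      by simp
  qed
  have "{j..k} = insert j (insert k {j<..<k})"
    using \<open>j < k\<close> by auto
  then have "?\<mu> n k = g i * \<P>(\<omega> in M. X 0 \<omega> = i) - (\<Sum>x\<in>{j<..<k}. g x * ?\<mu> n x)" for n
    using gamblers_ruin_dynkin[OF gr i \<open>k \<le> N\<close>, of g 0 n] g \<open>g j = 0\<close> \<open>g k = 1\<close> \<open>j < k\<close> by simp
  moreover have "(\<lambda>n. g i * \<P>(\<omega> in M. X 0 \<omega> = i) - (\<Sum>x\<in>{j<..<k}. g x * ?\<mu> n x))
      \<longlonglongrightarrow> g i * \<P>(\<omega> in M. X 0 \<omega> = i) - (\<Sum>x\<in>{j<..<k}. g x * 0)"
    using \<mu>_lim by (intro tendsto_intros) auto
  ultimately show ?thesis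
    by simp
qed

section \<open>From the stopped law to \<open>rho\<close> and \<open>expected_T\<close>\<close>

text \<open>The events of being frozen at \<open>k\<close> by time \<open>n\<close> increase to the
  event that \<open>k\<close> is hit before \<open>j\<close>; continuity from below and division by
  the probability of the start finish the proof.\<close>

lemma gamblers_ruin_rho_eq:
  assumes gr: "gamblers_ruin M N p q X" and "j < k"
    and pos: "0 < \<P>(\<omega> in M. X 0 \<omega> = i)"
    and lim: "(\<lambda>n. stopped_law M X {j, k} i n k) \<longlonglongrightarrow> c * \<P>(\<omega> in M. X 0 \<omega> = i)"
  shows "rho M X j i k = c"
proof -
  have mc: "markov_chain M {0..N} (gr_trans p q) X"
    using gr by (simp add: gamblers_ruin_def)
  interpret prob_space M
    using mc by (simp add: markov_chain_def)
  note [measurable] = markov_chain_measurable[OF mc] markov_chain_stopped_measurable[OF mc]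
  define E where "E n = {\<omega> \<in> space M. X 0 \<omega> = i \<and> stopped {j, k} (\<lambda>m. X m \<omega>) n = k}" for n
  have "(\<lambda>n. prob (E n)) \<longlonglongrightarrow> prob (\<Union>n. E n)"
    by (intro finite_Lim_measure_incseq incseq_SucI) (auto simp: E_def)
  moreover have "(\<Union>n. E n) =
      {\<omega> \<in> space M. hitting_time X {k} \<omega> < hitting_time X {j} \<omega> \<and> X 0 \<omega> = i}"
    using \<open>j < k\<close> by (auto simp: E_def hitting_time_less_iff_stopped)
  ultimately have "\<P>(\<omega> in M. hitting_time X {k} \<omega> < hitting_time X {j} \<omega> \<and> X 0 \<omega> = i) =
      c * \<P>(\<omega> in M. X 0 \<omega> = i)"
    using lim LIMSEQ_unique by (fastforce simp: stopped_law_def E_def)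
  with pos show ?thesis
    by (simp add: rho_def cond_prob_def)
qed

text \<open>The mean of a time with values in \<open>enat\<close> is the sum of its tails, and the
  tail at \<open>n\<close>, conditioned on the start, is the normalised interior mass at time
  \<open>n\<close>.\<close>

lemma gamblers_ruin_expected_T_eq:
  assumes gr: "gamblers_ruin M N p q X" and i: "i \<in> {j..k}" and "k \<le> N"
    and pos: "0 < \<P>(\<omega> in M. X 0 \<omega> = i)"
    and sums: "(\<lambda>n. \<Sum>x\<in>{j<..<k}. stopped_law M X {j, k} i n x) sums (c * \<P>(\<omega> in M. X 0 \<omega> = i))"
  shows "expected_T M X j i k = ereal c"
proof -
  have mc: "markov_chain M {0..N} (gr_trans p q) X"
    using gr by (simp add: gamblers_ruin_def)
  interpret prob_space M
    using mc by (simp add: markov_chain_def)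
  note [measurable] = markov_chain_measurable[OF mc] markov_chain_hitting_time_measurable[OF mc]
  define I where "I = {\<omega> \<in> space M. X 0 \<omega> = i}"
  define s where "s n = (\<Sum>x\<in>{j<..<k}. stopped_law M X {j, k} i n x)" for n
  have [measurable]: "I \<in> sets M"
    by (simp add: I_def)
  have s_nonneg: "0 \<le> s n" for n
    by (simp add: s_def sum_nonneg stopped_law_nonneg)
  have tail: "emeasure (uniform_measure M I) {\<omega> \<in> space M. enat n < hitting_time X {j, k} \<omega>} =
      ennreal (s n / prob I)" for n
  proof -
    have "prob (I \<inter> {\<omega> \<in> space M. enat n < hitting_time X {j, k} \<omega>}) =
        prob {\<omega> \<in> space M. X 0 \<omega> = i \<and> stopped {j, k} (\<lambda>m. X m \<omega>) n \<notin> {j, k}}"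
      by (intro arg_cong[where f = prob]) (auto simp: I_def less_hitting_time_iff_stopped)
    also have "\<dots> = (\<Sum>x\<in>{0..N} - {j, k}. stopped_law M X {j, k} i n x)"
      by (rule measure_stopped_notin[OF mc]) simp
    also have "\<dots> = s n"
      unfolding s_def
    proof (intro sum.mono_neutral_right ballI)
      fix x assume "x \<in> {0..N} - {j, k} - {j<..<k}"
      then have "x \<in> {0..N} - {j..k}"
        by auto
      then show "stopped_law M X {j, k} i n x = 0"
        by (rule gamblers_ruin_stopped_law_outside[OF gr i \<open>k \<le> N\<close>])
    qed (use \<open>k \<le> N\<close> in auto)
    finally show ?thesis
      using pos s_nonneg by (simp add: emeasure_eq_measure divide_ennreal I_def)
  qed
  have lim: "(\<lambda>n. s n / prob I) sums c"
    using sums_divide[OF sums, of "prob I"] pos by (simp add: s_def I_def)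
  \<comment> \<open>Since \<open>ennreal\<close> truncates negative reals to 0, the sign of
    \<open>c\<close> is needed to return to \<open>ereal c\<close>.\<close>
  then have "0 \<le> c"
    using sums_le[OF _ sums_zero lim] s_nonneg by simp
  have "(\<integral>\<^sup>+ \<omega>. ennreal_of_enat (hitting_time X {j, k} \<omega>) \<partial>uniform_measure M I) =
      (\<Sum>n. ennreal (s n / prob I))"
    by (subst nn_integral_enat_function) (simp_all add: tail)
  also have "\<dots> = ennreal c"
    using lim s_nonneg by (subst suminf_ennreal2) (auto simp: sums_iff)
  finally show ?thesis
    using \<open>0 \<le> c\<close> by (simp add: expected_T_def I_def)
qed

section \<open>Explicit solutions of the difference equations\<close>

theorem theorem2p1:
  fixes M :: "'a measure" and X :: "nat \<Rightarrow> 'a \<Rightarrow> nat"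
    and p q :: "nat \<Rightarrow> real" and N i j k :: nat
  assumes "2 \<le> N"
    and "\<And>s. s \<in> {1..N - 1} \<Longrightarrow> 0 < p s \<and> 0 < q s \<and> p s + q s \<le> 1"
    and "p 0 = 0" and "q 0 = 0" and "p N = 0" and "q N = 0"
    and "gamblers_ruin M N p q X"
    and "j \<le> i" and "i \<le> k" and "k \<le> N" and "j < k"
    and "0 < \<P>(\<omega> in M. X 0 \<omega> = i)"
  shows "(let r = lw_ratio p q; d = d_prod r j in
      rho M X j i k =
        (\<Sum>n = j + 1..i. \<Prod>s = j + 1..<n. r s) / (\<Sum>n = j + 1..k. \<Prod>s = j + 1..<n. r s) \<and>
      expected_T M X j i k =
        ereal ((\<Sum>n = j + 1..<k. d n * (\<Sum>s = j + 1..n. 1 / (p s * d s))) / (\<Sum>n = j..<k. d n)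
                 * (\<Sum>n = j..<i. d n)
               - (\<Sum>n = j + 1..<i. d n * (\<Sum>s = j + 1..n. 1 / (p s * d s)))))"
proof -
  define r where "r = lw_ratio p q"
  define d where "d = d_prod r j"
  \<comment> \<open>\<open>D\<close> is the scale function vanishing at \<open>j\<close>, with
    increments \<open>d\<close>; \<open>e\<close> gives the increments of a particular solution for
    the inhomogeneous equation, up to sign. The constant \<open>c\<close> is chosen to make
    \<open>h k = 0\<close>, and dividing by \<open>D k\<close> makes \<open>g k = 1\<close>.\<close>
  define D where "D x = (\<Sum>n = j..<x. d n)" for x
  define e where "e n = d n * (\<Sum>s = j + 1..n. 1 / (p s * d s))" for n
  define c where "c = (\<Sum>n = j + 1..<k. e n) / D k"
  define h where "h x = c * D x - (\<Sum>n = j + 1..<x. e n)" for x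
  define g where "g x = D x / D k" for x
  have i: "i \<in> {j..k}"
    using assms by simp
  have inner: "0 < p x" "0 < q x" if "j < x" "x < k" for x
    using that assms(2)[of x] \<open>k \<le> N\<close> by auto
  have d_pos: "0 < d n" if "n < k" for n
    using that inner by (auto simp: d_def d_prod_def r_def lw_ratio_def intro!: prod_pos divide_pos_pos)
  have D_pos: "0 < D k"
    unfolding D_def using \<open>j < k\<close> d_pos by (intro sum_pos) auto
  have d_rec: "p x * d x = q x * d (x - 1)" if "j < x" "x < k" for x
  proof -
    have "d x = d (x - 1) * r x"
      using that by (cases x) (auto simp: d_def d_prod_def)
    with inner[OF that] show ?thesis
      by (simp add: r_def lw_ratio_def)
  qed
  \<comment> \<open>Only the last summand of \<open>e x\<close> is new, and it contributes exactly 1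
    after multiplication by \<open>p x\<close>. At \<open>x = j + 1\<close> the recursion starts
    from \<open>e j = 0\<close>, an empty sum.\<close>
  have e_rec: "p x * e x = q x * e (x - 1) + 1" if "j < x" "x < k" for x
  proof -
    have "p x * e x = p x * d x * (\<Sum>s = j + 1..x - 1. 1 / (p s * d s)) + 1"
      using that inner[OF that] d_pos[of x] by (cases x) (auto simp: e_def field_simps)
    then show ?thesis
      using d_rec[OF that] by (simp add: e_def)
  qed
  have D_diff: "D (x + 1) - D x = d x" if "j \<le> x" for x
    using that by (simp add: D_def)
  \<comment> \<open>The sum in \<open>h\<close> starts at \<open>j + 1\<close>, so
    \<open>x = j\<close> is separate; there the missing term \<open>e j\<close> is 0.\<close>
  have h_diff: "h (x + 1) - h x = c * d x - e x" if "j \<le> x" for x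
    using that by (cases "x = j") (auto simp: h_def e_def D_def algebra_simps)
  have h: "p x * (h (x + 1) - h x) - q x * (h x - h (x - 1)) = - 1" if "j < x" "x < k" for x
  proof -
    have "h (x + 1) - h x = c * d x - e x" "h x - h (x - 1) = c * d (x - 1) - e (x - 1)"
      using h_diff[of x] h_diff[of "x - 1"] that by auto
    moreover have "p x * (c * d x - e x) - q x * (c * d (x - 1) - e (x - 1)) =
        c * (p x * d x - q x * d (x - 1)) - (p x * e x - q x * e (x - 1))"
      by (simp add: algebra_simps)
    ultimately show ?thesis
      using d_rec[OF that] e_rec[OF that] by simp
  qed
  have g: "p x * (g (x + 1) - g x) - q x * (g x - g (x - 1)) = 0" if "j < x" "x < k" for x
  proof -
    have "g (x + 1) - g x = d x / D k" "g x - g (x - 1) = d (x - 1) / D k"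
      using D_diff[of x] D_diff[of "x - 1"] that by (auto simp: g_def diff_divide_distrib[symmetric])
    then show ?thesis
      using d_rec[OF that] by simp
  qed
  have occupation: "(\<lambda>n. \<Sum>x\<in>{j<..<k}. stopped_law M X {j, k} i n x) sums (h i * \<P>(\<omega> in M. X 0 \<omega> = i))"
    using assms i h D_pos by (intro gamblers_ruin_occupation_sums) (auto simp: h_def c_def D_def)
  then have "(\<lambda>n. \<Sum>x\<in>{j<..<k}. stopped_law M X {j, k} i n x) \<longlonglongrightarrow> 0"
    by (intro summable_LIMSEQ_zero) (rule sums_summable)
  then have "(\<lambda>n. stopped_law M X {j, k} i n k) \<longlonglongrightarrow> g i * \<P>(\<omega> in M. X 0 \<omega> = i)"
    using assms i g D_pos by (intro gamblers_ruin_absorption_limit) (auto simp: g_def D_def)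
  then have rho: "rho M X j i k = g i"
    using assms by (intro gamblers_ruin_rho_eq)
  have expected: "expected_T M X j i k = ereal (h i)"
    using assms i occupation by (intro gamblers_ruin_expected_T_eq)
  \<comment> \<open>The products in the formula for \<open>rho\<close> stop at \<open>n - 1\<close>,
    so shifting the index by one turns them into \<open>d\<close>.\<close>
  have D_eq: "(\<Sum>n = j + 1..x. \<Prod>s = j + 1..<n. r s) = D x" for x
  proof -
    have "(\<Sum>n = j + 1..x. \<Prod>s = j + 1..<n. r s) = (\<Sum>n = j..<x. \<Prod>s = j + 1..<Suc n. r s)"
      by (rule sum.reindex_bij_witness[of _ Suc "\<lambda>n. n - 1"]) auto
    then show ?thesis
      by (simp add: D_def d_def d_prod_def atLeastLessThanSuc_atLeastAtMost)
  qed
  show ?thesis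
    unfolding Let_def r_def[symmetric] d_def[symmetric] D_eq
    using rho expected by (simp add: g_def h_def c_def e_def D_def)
qed

end
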